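(* Let $a(x)=\operatorname{arsinh}\sqrt{x}$ and $\varphi(x)=a(x)^2=\operatorname{arsinh}^2\sqrt{x}$ for $x>0$, and let $$h(x)=\frac{\varphi'(x)}{\varphi(x)}=2\,a'(x)\cdot\frac{1}{a(x)}=\frac{1}{\sqrt{x}\,\sqrt{1+x}\,\operatorname{arsinh}\sqrt{x}},\qquad x>0.$$ Then $h$ is (up to the constant factor $2$) a product of the two Stieltjes functions $a'$ and $1/a$; $h$ is completely monotone on $(0,\infty)$, and $h$ is not a Stieltjes function.
   Context: $\operatorname{arsinh}u=\log(u+\sqrt{1+u^2})$. A function $f:(0,\infty)\to[0,\infty)$ is completely monotone if $f\in C^\infty$ and $(-1)^n f^{(n)}(x)\ge 0$ for all $n\ge 0$, $x>0$. A function $f:(0,\infty)\to[0,\infty)$ is a Stieltjes function if $f(x)=\frac{\alpha}{x}+\beta+\int_{(0,\infty)}\frac{\sigma(dt)}{x+t}$ with $\alpha,\beta\ge 0$ and $\sigma$ a positive measure on $(0,\infty)$ with $\int_{(0,\infty)}\frac{\sigma(dt)}{1+t}<\infty$. *)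

theory Defs
  imports "HOL-Analysis.Analysis"
begin

text \<open>Functions on the open half-line are total functions on the reals of which only the
  values at positive arguments matter. In particular, \<^term>\<open>deriv\<close> at a positive point
  depends only on these values.\<close>

definition completely_monotone :: "(real \<Rightarrow> real) \<Rightarrow> bool" where
  "completely_monotone f \<longleftrightarrow>
     (\<forall>n. \<forall>x>0. (deriv ^^ n) f differentiable (at x)) \<and>
     (\<forall>n. \<forall>x>0. (-1) ^ n * (deriv ^^ n) f x \<ge> 0)"

definition stieltjes_function :: "(real \<Rightarrow> real) \<Rightarrow> bool" where
  "stieltjes_function f \<longleftrightarrow>
     (\<forall>x>0. f x \<ge> 0) \<and>
     (\<exists>\<alpha> \<beta> (\<sigma> :: real measure).
        \<alpha> \<ge> 0 \<and> \<beta> \<ge> 0 \<and>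
        sets \<sigma> = sets (restrict_space borel {0<..}) \<and>
        (\<integral>\<^sup>+ t. ennreal (1 / (1 + t)) \<partial>\<sigma>) < \<infinity> \<and>
        (\<forall>x>0. f x = \<alpha> / x + \<beta> + (\<integral>t. 1 / (x + t) \<partial>\<sigma>)))"

definition a_fun :: "real \<Rightarrow> real" where
  "a_fun x = arsinh (sqrt x)"

definition phi_fun :: "real \<Rightarrow> real" where
  "phi_fun x = (a_fun x)\<^sup>2"

definition h_fun :: "real \<Rightarrow> real" where
  "h_fun x = deriv phi_fun x / phi_fun x"

end

theory Submission
  imports Defs "HOL-Real_Asymp.Real_Asymp" "HOL-Complex_Analysis.Complex_Analysis"
begin

text \<open>
  Three ideas carry the proof.

  \<^emph>\<open>Representing measures.\<close> It is convenient to present a Stieltjes measure as the image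
  under a position map \<open>p\<close> of a measure on the real line with density \<open>w\<close>; then
  \<open>f\<close> is a Stieltjes function as soon as \<open>\<integral> w u / (x + p u) du = f x\<close>
  (lemma \<open>stieltjes_functionI\<close>). For \<open>a' x = 1 / (2 sqrt x sqrt (1 + x))\<close> an
  arctangent integral suffices. For \<open>1 / a\<close> put \<open>x = sinh\<^sup>2 y\<close>, so that
  \<open>1 / a x = 1 / y\<close>. The map \<open>z \<mapsto> sinh\<^sup>2 z\<close> sends the half strip
  \<open>Re z > 0\<close>, \<open>\<bar>Im z\<bar> < pi / 2\<close> conformally onto the plane cut along the
  negative half-line, and pulls the Cauchy kernel at \<open>x\<close> back to
  \<open>sinh (2 z) / (sinh\<^sup>2 z - sinh\<^sup>2 y)\<close>. Integrating this kernel times \<open>1 / z\<close> around the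
  rectangle \<open>[0, R] \<times> [- pi / 2, pi / 2]\<close> gives \<open>2 pi \<i> / y\<close>. The short edge through the
  origin contributes the part of the measure on \<open>(0, 1)\<close>, with \<open>t = sin\<^sup>2 u\<close>; the two long edges
  together contribute the part on \<open>[1, \<infinity>)\<close>, with \<open>t = cosh\<^sup>2 u\<close>; the edge at \<open>R\<close>
  contributes \<open>O(1 / R)\<close>. Both densities are nonnegative
  (lemmas \<open>contour_estimate\<close> and \<open>stieltjes_inverse_a_fun\<close>).

  \<^emph>\<open>Complete monotonicity.\<close> The defining sign conditions up to order \<open>n\<close> are stable under
  products, and they pass from \<open>f'\<close> to \<open>1 / f\<close> for positive \<open>f\<close>, because
  \<open>(1 / f)' = - f' (1 / f) (1 / f)\<close>. So \<open>h\<close> inherits them from powers of \<open>x\<close> and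
  \<open>x + 1\<close>.

  \<^emph>\<open>Not a Stieltjes function.\<close> For a Stieltjes function \<open>f\<close>, the product \<open>x f x\<close> tends to
  the mass \<open>\<alpha>\<close> at the origin as \<open>x \<rightarrow> 0\<close>, and \<open>f x \<ge> \<alpha> / x\<close> because all other terms are
  nonnegative. For \<open>h\<close> this limit is \<open>1\<close>, yet \<open>h x < 1 / x\<close> since \<open>tanh y < y\<close>.
\<close>

section \<open>Derivatives\<close>

lemma a_fun_pos: "x > 0 \<Longrightarrow> a_fun x > 0"
  by (simp add: a_fun_def)

lemma a_fun_has_deriv:
  assumes "x > 0"
  shows "(a_fun has_real_derivative 1 / (2 * sqrt x * sqrt (1 + x))) (at x)"
proof -
  have "((\<lambda>x. arsinh (sqrt x)) has_real_derivative
      1 / sqrt ((sqrt x)\<^sup>2 + 1) * (inverse (sqrt x) / 2)) (at x)"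
    by (rule DERIV_chain2 [OF arsinh_real_has_field_derivative DERIV_real_sqrt [OF assms]])
  then show ?thesis
    using assms by (simp add: a_fun_def [abs_def] field_simps)
qed

lemma deriv_a_fun: "x > 0 \<Longrightarrow> deriv a_fun x = 1 / (2 * sqrt x * sqrt (1 + x))"
  by (rule DERIV_imp_deriv [OF a_fun_has_deriv])

lemma phi_fun_has_deriv:
  assumes "x > 0"
  shows "(phi_fun has_real_derivative 2 * a_fun x * deriv a_fun x) (at x)"
  unfolding phi_fun_def [abs_def] deriv_a_fun [OF assms]
  by (auto intro!: derivative_eq_intros a_fun_has_deriv [OF assms] assms)

lemma h_fun_eq:
  assumes "x > 0"
  shows "h_fun x = 2 * deriv a_fun x * (1 / a_fun x)"
  using a_fun_pos [OF assms]
  by (simp add: h_fun_def DERIV_imp_deriv [OF phi_fun_has_deriv [OF assms]] phi_fun_def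
      power2_eq_square)

lemma h_fun_explicit:
  assumes "x > 0"
  shows "h_fun x = 1 / (sqrt x * sqrt (1 + x) * arsinh (sqrt x))"
  using assms by (simp add: h_fun_eq deriv_a_fun a_fun_def)

section \<open>Complete monotonicity\<close>

text \<open>Truncating at a finite order makes closure properties provable by plain induction on
  the order, with \<open>g = - f'\<close> again of the same kind, instead of by Leibniz-type formulas for the
  \<open>n\<close>-th derivative.\<close>
primrec cm_upto :: "nat \<Rightarrow> (real \<Rightarrow> real) \<Rightarrow> bool" where
  "cm_upto 0 f \<longleftrightarrow> (\<forall>x>0. f x \<ge> 0)"
| "cm_upto (Suc n) f \<longleftrightarrow> (\<forall>x>0. f x \<ge> 0) \<and>
     (\<exists>g. (\<forall>x>0. (f has_real_derivative - g x) (at x)) \<and> cm_upto n g)"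

lemma cm_upto_nonneg: "cm_upto n f \<Longrightarrow> x > 0 \<Longrightarrow> f x \<ge> 0"
  by (cases n) auto

lemma cm_upto_SucI:
  assumes "\<And>x. x > 0 \<Longrightarrow> f x \<ge> 0"
    and "\<And>x. x > 0 \<Longrightarrow> (f has_real_derivative - g x) (at x)" and "cm_upto n g"
  shows "cm_upto (Suc n) f"
  unfolding cm_upto.simps using assms by blast

lemma cm_upto_SucE:
  assumes "cm_upto (Suc n) f"
  obtains g where "\<And>x. x > 0 \<Longrightarrow> (f has_real_derivative - g x) (at x)" "cm_upto n g"
  using assms unfolding cm_upto.simps by blast

lemma cm_upto_Suc_imp: "cm_upto (Suc n) f \<Longrightarrow> cm_upto n f"
proof (induction n arbitrary: f)
  case (Suc n)
  obtain g where g: "\<And>x. x > 0 \<Longrightarrow> (f has_real_derivative - g x) (at x)" "cm_upto (Suc n) g"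
    using cm_upto_SucE [OF Suc.prems] by blast
  show ?case
    by (rule cm_upto_SucI [OF cm_upto_nonneg [OF Suc.prems] g(1) Suc.IH [OF g(2)]])
qed auto

lemma cm_upto_add: "cm_upto n f \<Longrightarrow> cm_upto n g \<Longrightarrow> cm_upto n (\<lambda>x. f x + g x)"
proof (induction n arbitrary: f g)
  case (Suc n)
  obtain f' where f': "\<And>x. x > 0 \<Longrightarrow> (f has_real_derivative - f' x) (at x)" "cm_upto n f'"
    using cm_upto_SucE [OF Suc.prems(1)] by blast
  obtain g' where g': "\<And>x. x > 0 \<Longrightarrow> (g has_real_derivative - g' x) (at x)" "cm_upto n g'"
    using cm_upto_SucE [OF Suc.prems(2)] by blast
  show ?case
  proof (rule cm_upto_SucI)
    show "((\<lambda>x. f x + g x) has_real_derivative - (f' x + g' x)) (at x)" if "x > 0" for x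
      using DERIV_add [OF f'(1) [OF that] g'(1) [OF that]] by simp
  qed (use cm_upto_nonneg [OF Suc.prems(1)] cm_upto_nonneg [OF Suc.prems(2)] Suc.IH [OF f'(2) g'(2)] in \<open>simp_all del: cm_upto.simps\<close>)
qed auto

lemma cm_upto_mult: "cm_upto n f \<Longrightarrow> cm_upto n g \<Longrightarrow> cm_upto n (\<lambda>x. f x * g x)"
proof (induction n arbitrary: f g)
  case (Suc n)
  obtain f' where f': "\<And>x. x > 0 \<Longrightarrow> (f has_real_derivative - f' x) (at x)" "cm_upto n f'"
    using cm_upto_SucE [OF Suc.prems(1)] by blast
  obtain g' where g': "\<And>x. x > 0 \<Longrightarrow> (g has_real_derivative - g' x) (at x)" "cm_upto n g'"
    using cm_upto_SucE [OF Suc.prems(2)] by blast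
  show ?case
  proof (rule cm_upto_SucI)
    show "((\<lambda>x. f x * g x) has_real_derivative - (f' x * g x + f x * g' x)) (at x)"
      if "x > 0" for x
    proof -
      have "- f' x * g x + - g' x * f x = - (f' x * g x + f x * g' x)"
        by (simp add: algebra_simps)
      with DERIV_mult [OF f'(1) [OF that] g'(1) [OF that]] show ?thesis by (rule back_subst)
    qed
    show "cm_upto n (\<lambda>x. f' x * g x + f x * g' x)"
      using f'(2) g'(2) Suc.prems [THEN cm_upto_Suc_imp] Suc.IH by (intro cm_upto_add) blast+
  qed (use cm_upto_nonneg [OF Suc.prems(1)] cm_upto_nonneg [OF Suc.prems(2)] in \<open>simp_all del: cm_upto.simps\<close>)
qed auto

lemma cm_upto_const: "c \<ge> 0 \<Longrightarrow> cm_upto n (\<lambda>x. c)"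
proof (induction n arbitrary: c)
  case (Suc n)
  show ?case
    by (rule cm_upto_SucI [where g = "\<lambda>x. 0"]) (use Suc in \<open>simp_all del: cm_upto.simps\<close>)
qed auto

lemma cm_upto_shifted_power:
  assumes "c \<ge> 0" "s \<ge> 0"
  shows "cm_upto n (\<lambda>x. (x + c) powr - s)"
  using assms(2)
proof (induction n arbitrary: s)
  case (Suc n)
  show ?case
  proof (rule cm_upto_SucI)
    show "((\<lambda>x. (x + c) powr - s) has_real_derivative - (s * (x + c) powr - (s + 1))) (at x)"
      if "x > 0" for x
      using that assms(1) by (auto intro!: derivative_eq_intros)
    show "cm_upto n (\<lambda>x. s * (x + c) powr - (s + 1))"
      using Suc.prems by (intro cm_upto_mult [OF cm_upto_const Suc.IH]) auto
  qed auto
qed auto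

text \<open>The derivative of \<open>1 / f\<close> is minus the product of \<open>f'\<close> with two copies of \<open>1 / f\<close>, so
  control of \<open>1 / f\<close> up to order \<open>n\<close> yields control up to order \<open>n + 1\<close>. In other words,
  the reciprocal of a positive Bernstein function is completely monotone.\<close>
lemma cm_upto_inverse:
  assumes pos: "\<And>x. x > 0 \<Longrightarrow> f x > 0"
    and deriv: "\<And>x. x > 0 \<Longrightarrow> (f has_real_derivative g x) (at x)"
    and g: "\<And>n. cm_upto n g"
  shows "cm_upto n (\<lambda>x. 1 / f x)"
proof (induction n)
  case 0
  show ?case using pos by (auto intro: less_imp_le)
next
  case (Suc n)
  show ?case
  proof (rule cm_upto_SucI)
    show "((\<lambda>x. 1 / f x) has_real_derivative - (g x * ((1 / f x) * (1 / f x)))) (at x)"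
      if "x > 0" for x
      using pos [OF that] by (auto intro!: derivative_eq_intros deriv that)
    show "cm_upto n (\<lambda>x. g x * ((1 / f x) * (1 / f x)))"
      by (rule cm_upto_mult [OF g cm_upto_mult [OF Suc.IH Suc.IH]])
  qed (use pos in \<open>auto intro: less_imp_le\<close>)
qed

text \<open>Higher derivatives of total functions are compared only on the positive half-line. The
  factor \<open>c\<close> absorbs the sign that each differentiation produces, which makes the induction
  go through.\<close>
lemma cm_upto_funpow_deriv:
  assumes "cm_upto (Suc n) f" "\<And>x. x > 0 \<Longrightarrow> F x = c * f x" "x > 0"
  shows "(deriv ^^ n) F differentiable (at x) \<and>
    (\<exists>q\<ge>0. (deriv ^^ n) F x = c * (-1) ^ n * q)"
  using assms(1,2)
proof (induction n arbitrary: f F c)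
  case 0
  then obtain g where g: "\<And>x. x > 0 \<Longrightarrow> (f has_real_derivative - g x) (at x)"
    using cm_upto_SucE [OF 0(1)] by blast
  have "((\<lambda>x. c * f x) has_real_derivative c * - g x) (at x)"
    by (rule DERIV_cmult [OF g [OF \<open>x > 0\<close>]])
  then have "(F has_real_derivative c * - g x) (at x)"
    by (rule has_field_derivative_transform_within_open [where S = "{0<..}"])
      (use 0 \<open>x > 0\<close> in auto)
  then show ?case
    using cm_upto_nonneg [OF 0(1) \<open>x > 0\<close>] 0(2) [OF \<open>x > 0\<close>]
    by (auto simp: real_differentiable_def simp del: cm_upto.simps)
next
  case (Suc n)
  obtain g where g: "\<And>x. x > 0 \<Longrightarrow> (f has_real_derivative - g x) (at x)" "cm_upto (Suc n) g"
    using cm_upto_SucE [OF Suc.prems(1)] by blast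
  have "deriv F t = (- c) * g t" if "t > 0" for t
  proof -
    have "((\<lambda>x. c * f x) has_real_derivative c * - g t) (at t)"
      by (rule DERIV_cmult [OF g(1) [OF that]])
    then have "(F has_real_derivative c * - g t) (at t)"
      by (rule has_field_derivative_transform_within_open [where S = "{0<..}"])
        (use Suc.prems that in auto)
    then show ?thesis by (simp add: DERIV_imp_deriv)
  qed
  from Suc.IH [OF g(2) this] show ?case
    unfolding funpow_Suc_right comp_def by simp
qed

lemma completely_monotoneI:
  assumes "\<And>n. cm_upto n f"
  shows "completely_monotone f"
proof -
  have "(deriv ^^ n) f differentiable (at x) \<and> (-1) ^ n * (deriv ^^ n) f x \<ge> 0"
    if "x > 0" for n x
  proof -
    obtain q where q: "q \<ge> 0" "(deriv ^^ n) f x = 1 * (-1) ^ n * q"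
      "(deriv ^^ n) f differentiable (at x)"
      using cm_upto_funpow_deriv [OF assms, of f 1 x n] \<open>x > 0\<close> by auto
    have "(-1) ^ n * (deriv ^^ n) f x = ((-1) * (-1)) ^ n * q"
      unfolding q(2) power_mult_distrib by simp
    then show ?thesis using q by simp
  qed
  then show ?thesis by (simp add: completely_monotone_def)
qed

lemma cm_upto_cong:
  assumes "cm_upto n f" "\<And>x. x > 0 \<Longrightarrow> F x = f x"
  shows "cm_upto n F"
proof (cases n)
  case (Suc m)
  obtain g where g: "\<And>x. x > 0 \<Longrightarrow> (f has_real_derivative - g x) (at x)" "cm_upto m g"
    using cm_upto_SucE assms(1) Suc by blast
  have "(F has_real_derivative - g x) (at x)" if "x > 0" for x
    by (rule has_field_derivative_transform_within_open [OF g(1) [OF that], where S = "{0<..}"])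
      (use assms that in auto)
  then show ?thesis
    using g(2) assms(2) cm_upto_nonneg [OF assms(1)] Suc by (auto intro!: cm_upto_SucI [where g = g] simp del: cm_upto.simps)
qed (use assms in auto)

lemma completely_monotone_h_fun: "completely_monotone h_fun"
proof (rule completely_monotoneI)
  fix n
  define p where "p x = x powr - (1/2) * (x + 1) powr - (1/2)" for x :: real
  have p: "p x = 1 / (sqrt x * sqrt (1 + x))" if "x > 0" for x
    using that by (simp add: p_def powr_minus powr_half_sqrt field_simps)
  have cm: "cm_upto n p" for n
    unfolding p_def
    using cm_upto_mult [OF cm_upto_shifted_power [of 0 "1/2"] cm_upto_shifted_power [of 1 "1/2"]]
    by simp
  have "cm_upto n (\<lambda>x. 1 / a_fun x)"
  proof (rule cm_upto_inverse [OF a_fun_pos])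
    show "(a_fun has_real_derivative 1 / 2 * p x) (at x)" if "x > 0" for x
      using a_fun_has_deriv [OF that] by (simp add: p [OF that] mult_ac)
    show "cm_upto n (\<lambda>x. 1 / 2 * p x)" for n
      by (rule cm_upto_mult [OF cm_upto_const cm]) simp
  qed
  from cm_upto_mult [OF cm this] show "cm_upto n h_fun"
    by (rule cm_upto_cong) (simp add: h_fun_explicit p a_fun_def)
qed

section \<open>The mass at the origin of a Stieltjes function\<close>

text \<open>After multiplication by \<open>x\<close>, the integrand \<open>x / (x + t)\<close> tends to \<open>0\<close> for each
  \<open>t > 0\<close> and is dominated by \<open>1 / (1 + t)\<close> when \<open>x \<le> 1\<close>; only the pole at the origin
  survives.\<close>
lemma stieltjes_pole_part:
  assumes sets: "sets \<sigma> = sets (restrict_space borel {0<..})"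
    and fin: "(\<integral>\<^sup>+ t. ennreal (1 / (1 + t)) \<partial>\<sigma>) < \<infinity>"
    and f: "\<And>x. x > 0 \<Longrightarrow> f x = \<alpha> / x + \<beta> + (\<integral>t. 1 / (x + t) \<partial>\<sigma>)"
  shows "(\<lambda>n. f (1 / real (Suc n)) / real (Suc n)) \<longlonglongrightarrow> \<alpha>"
proof -
  have space: "space \<sigma> = {0<..}"
    using sets_eq_imp_space_eq [OF sets] by (simp add: space_restrict_space)
  have meas: "g \<in> borel_measurable \<sigma>" if "g \<in> borel_measurable borel" for g :: "real \<Rightarrow> real"
    unfolding measurable_cong_sets [OF sets refl] by (rule measurable_restrict_space1 [OF that])
  define x where "x n = 1 / real (Suc n)" for n
  have x: "x n > 0" "x n \<le> 1" for n by (auto simp: x_def field_simps)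
  have x0: "x \<longlonglongrightarrow> 0" unfolding x_def by real_asymp
  have "(\<lambda>n. \<integral>t. x n / (x n + t) \<partial>\<sigma>) \<longlonglongrightarrow> (\<integral>t. 0 \<partial>\<sigma>)"
  proof (rule integral_dominated_convergence [where w = "\<lambda>t. 1 / (1 + t)"])
    show "integrable \<sigma> (\<lambda>t. 1 / (1 + t))"
      using fin by (intro integrableI_nonneg meas) (auto simp: space)
    show "AE t in \<sigma>. (\<lambda>n. x n / (x n + t)) \<longlonglongrightarrow> 0"
      using x0 by (auto intro!: AE_I2 tendsto_eq_intros simp: space)
    show "AE t in \<sigma>. norm (x n / (x n + t)) \<le> 1 / (1 + t)" for n
      using x [of n] by (auto intro!: AE_I2 simp: space field_simps)
  qed (auto intro!: meas)
  then have "(\<lambda>n. \<alpha> + \<beta> * x n + (\<integral>t. x n / (x n + t) \<partial>\<sigma>)) \<longlonglongrightarrow> \<alpha>"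
    using x0 by (auto intro!: tendsto_eq_intros)
  also have "(\<lambda>n. \<alpha> + \<beta> * x n + (\<integral>t. x n / (x n + t) \<partial>\<sigma>)) = (\<lambda>n. x n * f (x n))"
  proof
    fix n
    have "(\<integral>t. x n / (x n + t) \<partial>\<sigma>) = x n * (\<integral>t. 1 / (x n + t) \<partial>\<sigma>)"
      by (subst integral_mult_right_zero [symmetric]) simp
    then show "\<alpha> + \<beta> * x n + (\<integral>t. x n / (x n + t) \<partial>\<sigma>) = x n * f (x n)"
      using x(1) [of n] by (simp add: f algebra_simps)
  qed
  finally show ?thesis by (simp add: x_def)
qed

lemma stieltjes_ge_pole_part:
  assumes "stieltjes_function f" "(\<lambda>n. f (1 / real (Suc n)) / real (Suc n)) \<longlonglongrightarrow> c" "x > 0"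
  shows "f x \<ge> c / x"
proof -
  obtain \<alpha> \<beta> and \<sigma> :: "real measure" where 1: "\<beta> \<ge> 0"
    "sets \<sigma> = sets (restrict_space borel {0<..})"
    "(\<integral>\<^sup>+ t. ennreal (1 / (1 + t)) \<partial>\<sigma>) < \<infinity>"
    "\<And>x. x > 0 \<Longrightarrow> f x = \<alpha> / x + \<beta> + (\<integral>t. 1 / (x + t) \<partial>\<sigma>)"
    using assms(1) unfolding stieltjes_function_def by blast
  have "\<alpha> = c"
    by (rule LIMSEQ_unique [OF stieltjes_pole_part [OF 1(2-4)] assms(2)])
  moreover have "space \<sigma> = {0<..}"
    using sets_eq_imp_space_eq [OF 1(2)] by (simp add: space_restrict_space)
  then have "(\<integral>t. 1 / (x + t) \<partial>\<sigma>) \<ge> 0"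
    using assms(3) by (intro integral_nonneg_AE AE_I2) auto
  ultimately show ?thesis
    using 1 assms(3) by simp
qed

text \<open>With \<open>x = sinh\<^sup>2 y\<close> this is the inequality \<open>tanh y < y\<close>.\<close>
lemma h_fun_less:
  assumes "x > 0" shows "h_fun x < 1 / x"
proof -
  define y where "y = arsinh (sqrt x)"
  have y: "y > 0" "sinh y = sqrt x" using assms by (auto simp: y_def)
  have c: "cosh y = sqrt (1 + x)"
    using assms y(2) cosh_square_eq [of y] by (intro real_sqrt_unique [symmetric]) auto
  have "sinh y < y * cosh y"
  proof -
    have "0 * cosh 0 - sinh 0 < y * cosh y - sinh y"
    proof (rule DERIV_pos_imp_increasing_open [OF y(1)])
      show "\<exists>d. ((\<lambda>y. y * cosh y - sinh y) has_real_derivative d) (at t) \<and> 0 < d"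
        if "0 < t" "t < y" for t
        by (rule exI [of _ "t * sinh t"]) (use that in \<open>auto intro!: derivative_eq_intros\<close>)
    qed (auto intro!: continuous_intros)
    then show ?thesis by simp
  qed
  then have "sqrt x * sqrt x < sqrt x * (sqrt (1 + x) * y)"
    using assms y c by (intro mult_strict_left_mono) (auto simp: mult.commute)
  then have "x < sqrt x * sqrt (1 + x) * y"
    using assms by (simp add: mult.assoc)
  then show ?thesis
    using assms y by (simp add: h_fun_explicit y_def [symmetric] frac_less2)
qed

lemma not_stieltjes_h_fun: "\<not> stieltjes_function h_fun"
proof
  assume st: "stieltjes_function h_fun"
  have "(\<lambda>n. 1 / (sqrt (1 / real (Suc n)) * sqrt (1 + 1 / real (Suc n)) *
      ln (sqrt (1 / real (Suc n)) + sqrt ((sqrt (1 / real (Suc n)))^2 + 1))) / real (Suc n)) \<longlonglongrightarrow> 1"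
    by real_asymp
  then have "(\<lambda>n. h_fun (1 / real (Suc n)) / real (Suc n)) \<longlonglongrightarrow> 1"
    by (subst h_fun_explicit) (simp_all add: arsinh_real_def)
  from stieltjes_ge_pole_part [OF st this, of 1] h_fun_less [of 1] show False
    by simp
qed

section \<open>Stieltjes functions from weighted position maps\<close>

text \<open>Parametrising the support by \<open>p\<close> spares all substitutions in integrals. The integral
  hypothesis at \<open>x = 1\<close> is the integrability condition on the measure.\<close>
lemma stieltjes_functionI:
  fixes w p :: "real \<Rightarrow> real"
  assumes [measurable]: "w \<in> borel_measurable borel" "p \<in> borel_measurable borel"
    and w: "\<And>u. w u \<ge> 0" and p: "\<And>u. p u > 0"
    and f: "\<And>x. x > 0 \<Longrightarrow> f x \<ge> 0"
    and int: "\<And>x. x > 0 \<Longrightarrow> (\<integral>\<^sup>+ u. ennreal (w u / (x + p u)) \<partial>lborel) = ennreal (f x)"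
  shows "stieltjes_function f"
proof -
  define N where "N = restrict_space (borel :: real measure) {0<..}"
  define \<sigma> where "\<sigma> = distr (density lborel w) N p"
  have p_meas: "p \<in> measurable (density lborel w) N"
    using p by (auto simp: N_def intro!: measurable_restrict_space2)
  have sets: "sets \<sigma> = sets N" by (simp add: \<sigma>_def)
  have meas: "(\<lambda>t. 1 / (x + t)) \<in> borel_measurable N" for x :: real
    unfolding N_def by (rule measurable_restrict_space1) measurable
  have nn: "(\<integral>\<^sup>+ t. ennreal (1 / (x + t)) \<partial>\<sigma>) = ennreal (f x)" if "x > 0" for x
  proof -
    have "(\<integral>\<^sup>+ t. ennreal (1 / (x + t)) \<partial>\<sigma>) =
        (\<integral>\<^sup>+ u. ennreal (1 / (x + p u)) \<partial>density lborel w)"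
      unfolding \<sigma>_def using meas by (intro nn_integral_distr p_meas) simp
    also have "\<dots> = (\<integral>\<^sup>+ u. ennreal (w u) * ennreal (1 / (x + p u)) \<partial>lborel)"
      by (intro nn_integral_density) auto
    also have "\<dots> = (\<integral>\<^sup>+ u. ennreal (w u / (x + p u)) \<partial>lborel)"
      using w p by (intro nn_integral_cong) (simp add: ennreal_mult' [symmetric])
    finally show ?thesis using int [OF that] by simp
  qed
  have space: "space \<sigma> = {0<..}"
    by (simp add: \<sigma>_def N_def space_restrict_space)
  have bochner: "(\<integral>t. 1 / (x + t) \<partial>\<sigma>) = f x" if "x > 0" for x
    using that f [OF that] nn [OF that] meas
    by (subst integral_eq_nn_integral) (auto simp: space measurable_cong_sets [OF sets refl])
  show ?thesis
    unfolding stieltjes_function_def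
    by (intro conjI allI impI f exI [of _ 0] exI [of _ \<sigma>])
      (use nn [of 1] sets bochner in \<open>auto simp: N_def\<close>)
qed

section \<open>The derivative of the inverse hyperbolic sine of the square root\<close>

lemma nn_integral_inverse_quadratic:
  fixes x :: real
  assumes "x > 0"
  shows "(\<integral>\<^sup>+ u. ennreal (1 / (x + (1 + x) * u\<^sup>2)) * indicator {0..} u \<partial>lborel) =
    ennreal (pi / (2 * sqrt x * sqrt (1 + x)))"
proof -
  define r s where "r = sqrt x" and "s = sqrt (1 + x)"
  have rs: "r > 0" "s > 0" "x = r\<^sup>2" "1 + x = s\<^sup>2" using assms by (auto simp: r_def s_def)
  define F where "F u = arctan (s / r * u) / (r * s)" for u
  have D: "(F has_real_derivative 1 / (x + (1 + x) * u\<^sup>2)) (at u)" for u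
  proof -
    have "(F has_real_derivative (inverse (1 + (s / r * u)\<^sup>2) * (s / r)) / (r * s)) (at u)"
      unfolding F_def using rs(1,2) by (auto intro!: derivative_eq_intros)
    also have "(inverse (1 + (s / r * u)\<^sup>2) * (s / r)) / (r * s) = 1 / (r\<^sup>2 + (s * u)\<^sup>2)"
    proof -
      have "1 + (s / r * u)\<^sup>2 = (r\<^sup>2 + (s * u)\<^sup>2) / r\<^sup>2"
        using rs(1) by (simp add: field_simps power2_eq_square)
      then show ?thesis
        using rs(1,2) by (simp add: power2_eq_square)
    qed
    also have "r\<^sup>2 + (s * u)\<^sup>2 = x + (1 + x) * u\<^sup>2"
      using rs(3,4) by (simp add: power_mult_distrib)
    finally show ?thesis .
  qed
  have "filterlim (\<lambda>u. s / r * u) at_top at_top"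
    using rs by (intro filterlim_tendsto_pos_mult_at_top [OF tendsto_const _ filterlim_ident]) auto
  then have lim: "(F \<longlongrightarrow> (pi / 2) / (r * s)) at_top"
    unfolding F_def using rs
    by (intro tendsto_divide tendsto_const filterlim_compose [OF tendsto_arctan_at_top]) auto
  show ?thesis
    by (subst nn_integral_FTC_atLeast [OF _ D _ lim])
      (use assms in \<open>auto simp: F_def r_def s_def mult_ac\<close>)
qed

lemma stieltjes_inverse_sqrt:
  "stieltjes_function (\<lambda>x. 1 / (2 * sqrt x * sqrt (1 + x)))"
proof (rule stieltjes_functionI)
  \<comment> \<open>The arcsine density on \<open>(0, 1)\<close> in the parameter \<open>u = tan \<theta>\<close> with
    \<open>t = sin\<^sup>2 \<theta> = u\<^sup>2 / (1 + u\<^sup>2)\<close>.\<close>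
  let ?w = "\<lambda>u::real. if u > 0 then 1 / (pi * (1 + u\<^sup>2)) else 0"
  let ?p = "\<lambda>u::real. if u > 0 then u\<^sup>2 / (1 + u\<^sup>2) else 1"
  show "(\<integral>\<^sup>+ u. ennreal (?w u / (x + ?p u)) \<partial>lborel) =
      ennreal (1 / (2 * sqrt x * sqrt (1 + x)))" if "x > 0" for x :: real
  proof -
    have eq: "?w u / (x + ?p u) = 1 / pi * (1 / (x + (1 + x) * u\<^sup>2))" if "u > 0" for u
    proof -
      have pos: "1 + u\<^sup>2 > 0" by (simp add: add_pos_nonneg)
      then have "x + u\<^sup>2 / (1 + u\<^sup>2) = (x + (1 + x) * u\<^sup>2) / (1 + u\<^sup>2)"
        by (simp add: field_simps)
      then show ?thesis using \<open>u > 0\<close> pos by simp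
    qed
    have "(\<integral>\<^sup>+ u. ennreal (?w u / (x + ?p u)) \<partial>lborel) =
      (\<integral>\<^sup>+ u. ennreal (1 / pi) * (ennreal (1 / (x + (1 + x) * u\<^sup>2)) * indicator {0..} u) \<partial>lborel)"
    proof (rule nn_integral_cong_AE, rule AE_mp [OF AE_lborel_singleton [of 0]], rule AE_I2, rule impI)
      fix u :: real assume "u \<noteq> 0"
      then show "ennreal (?w u / (x + ?p u)) =
          ennreal (1 / pi) * (ennreal (1 / (x + (1 + x) * u\<^sup>2)) * indicator {0..} u)"
        using eq [of u] \<open>x > 0\<close> by (cases "u > 0") (auto simp: ennreal_mult' [symmetric])
    qed
    also have "\<dots> = ennreal (1 / pi) * ennreal (pi / (2 * sqrt x * sqrt (1 + x)))"
      using \<open>x > 0\<close> by (subst nn_integral_cmult) (auto simp: nn_integral_inverse_quadratic)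
    also have "\<dots> = ennreal (1 / (2 * sqrt x * sqrt (1 + x)))"
      using \<open>x > 0\<close> by (simp add: ennreal_mult' [symmetric])
    finally show ?thesis .
  qed
qed (auto intro!: divide_pos_pos add_pos_nonneg)

lemma stieltjes_deriv_a_fun: "stieltjes_function (deriv a_fun)"
  using stieltjes_inverse_sqrt by (simp add: stieltjes_function_def deriv_a_fun)

section \<open>The Cauchy kernel in a half strip\<close>

lemma sinh_of_real: "sinh (of_real x) = (of_real (sinh x) :: complex)"
  unfolding sinh_field_def of_real_divide of_real_add of_real_diff of_real_numeral exp_of_real [symmetric] by simp

lemma cosh_of_real: "cosh (of_real x) = (of_real (cosh x) :: complex)"
  unfolding cosh_field_def of_real_divide of_real_add of_real_diff of_real_numeral exp_of_real [symmetric] by simp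

lemma sinh_eq_0_in_strip:
  fixes z :: complex
  assumes "\<bar>Im z\<bar> < pi"
  shows "sinh z = 0 \<longleftrightarrow> z = 0"
proof
  assume "sinh z = 0"
  then have "sin (\<i> * z) = 0" by (simp add: sinh_conv_sin)
  then obtain n :: int where n: "\<i> * z = of_real (n * pi)" by (auto simp: sin_eq_0)
  then have "Re z = 0" "Im z = - (n * pi)"
    by (auto simp: complex_eq_iff)
  moreover have "\<bar>real_of_int n\<bar> < 1"
    using assms calculation(2) by (simp add: abs_mult)
  ultimately show "z = 0" by (simp add: complex_eq_iff)
qed simp

lemma sinh_diff_times_sinh_add:
  fixes a b :: "'a :: {banach, real_normed_field}"
  shows "sinh (a - b) * sinh (a + b) = (sinh a)\<^sup>2 - (sinh b)\<^sup>2"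
proof -
  have "sinh (a - b) * sinh (a + b) =
      (sinh a)\<^sup>2 * (cosh b)\<^sup>2 - (cosh a)\<^sup>2 * (sinh b)\<^sup>2"
    by (simp add: sinh_add sinh_diff algebra_simps power2_eq_square)
  then show ?thesis
    by (simp add: cosh_square_eq algebra_simps)
qed

lemma has_contour_integral_linepath_same_Im_iff:
  assumes "a < b"
  shows "(f has_contour_integral I) (linepath (Complex a c) (Complex b c)) \<longleftrightarrow>
    ((\<lambda>s. f (Complex s c)) has_integral I) {a..b}"
proof -
  have "(f has_contour_integral I) (linepath (Complex a c) (Complex b c)) \<longleftrightarrow>
      ((\<lambda>z. f (z + Complex 0 c)) has_contour_integral I) (linepath (of_real a) (of_real b))"
    unfolding has_contour_integral_linepath
    by (intro has_integral_cong) (simp add: linepath_def complex_eq_iff scaleR_conv_of_real Complex_eq algebra_simps)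
  also have "\<dots> \<longleftrightarrow> ((\<lambda>s. f (of_real s + Complex 0 c)) has_integral I) {a..b}"
    using assms by (subst has_contour_integral_linepath_Reals_iff) auto
  also have "(\<lambda>s. f (of_real s + Complex 0 c)) = (\<lambda>s. f (Complex s c))"
    by (simp add: Complex_eq)
  finally show ?thesis .
qed

text \<open>The function \<open>1 / z\<close> times the Cauchy kernel \<open>d\<zeta> / (\<zeta> - x)\<close>, pulled back by
  \<open>\<zeta> = sinh\<^sup>2 z\<close> with \<open>x = sinh\<^sup>2 y\<close>. At \<open>z = 0\<close> it has a removable singularity, at \<open>z = y\<close> a
  simple pole with residue \<open>1 / y\<close>.\<close>
definition strip_kernel :: "real \<Rightarrow> complex \<Rightarrow> complex" where
  "strip_kernel y z = sinh (2 * z) / (z * ((sinh z)\<^sup>2 - of_real ((sinh y)\<^sup>2)))"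

text \<open>Up to constant factors, \<open>left_edge\<close> is the kernel on the imaginary axis and \<open>long_edges\<close> is
  the difference of its values on the two lines \<open>Im z = \<plusminus> pi / 2\<close>.\<close>
definition left_edge :: "real \<Rightarrow> real \<Rightarrow> real" where
  "left_edge y t = sin (2 * t) / (t * ((sin t)\<^sup>2 + (sinh y)\<^sup>2))"

definition long_edges :: "real \<Rightarrow> real \<Rightarrow> real" where
  "long_edges y s = pi * sinh (2 * s) / (((cosh s)\<^sup>2 + (sinh y)\<^sup>2) * (s\<^sup>2 + (pi / 2)\<^sup>2))"

text \<open>Since \<open>sinh\<^sup>2 z - sinh\<^sup>2 y = sinh (z - y) sinh (z + y)\<close>, dividing out the zeros of
  \<open>sinh (2 z)\<close> at \<open>0\<close> and of \<open>sinh (z - y)\<close> at \<open>y\<close> turns the kernel into \<open>F z / (z - y)\<close> with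
  \<open>F\<close> holomorphic in a convex neighbourhood of the half strip and \<open>F y = 1 / y\<close>. The claim is
  then Cauchy's integral formula. The function \<open>G\<close> is the kernel with its singularity
  on the contour, at \<open>0\<close>, filled in.\<close>
lemma contour_integral_strip_kernel:
  assumes y: "0 < y" "y < R"
  obtains G where "(G has_contour_integral 2 * pi * \<i> / y)
      (rectpath (Complex 0 (- (pi / 2))) (Complex R (pi / 2)))"
    and "continuous_on ({z. Re z \<ge> 0 \<and> \<bar>Im z\<bar> \<le> pi / 2} - {of_real y}) G"
    and "\<And>z. z \<noteq> 0 \<Longrightarrow> z \<noteq> of_real y \<Longrightarrow> G z = strip_kernel y z"
proof -
  define S where "S = {z. Re z > - y} \<inter> {z. Im z < pi} \<inter> {z. - pi < Im z}"
  have S: "open S" "convex S"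
    unfolding S_def
    by (intro open_Int open_halfspace_Re_gt open_halfspace_Im_lt open_halfspace_Im_gt
        convex_Int convex_halfspace_Re_gt convex_halfspace_Im_lt convex_halfspace_Im_gt)+
  have strip: "z \<in> S" if "Re z \<ge> 0" "\<bar>Im z\<bar> \<le> pi / 2" for z
  proof -
    have "Im z < pi" "- pi < Im z" using that(2) pi_gt_zero by linarith+
    then show ?thesis using that(1) y by (simp add: S_def)
  qed
  define H where "H z = (if z = 0 then deriv (\<lambda>z. sinh (2 * z)) 0
      else (sinh (2 * z) - sinh (2 * 0)) / (z - 0))" for z :: complex
  define K where "K z = (if z = 0 then deriv sinh 0 else (sinh z - sinh 0) / (z - 0))" for z :: complex
  have K0: "K 0 = 1"
    unfolding K_def by (auto intro!: DERIV_imp_deriv derivative_eq_intros)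
  have K: "K z * z = sinh z" for z by (simp add: K_def)
  have holH: "H holomorphic_on UNIV"
    unfolding H_def [abs_def] by (rule pole_lemma_open [OF analytic_imp_holomorphic]) (auto intro!: analytic_intros)
  have holK: "K holomorphic_on UNIV"
    unfolding K_def [abs_def] by (rule pole_lemma_open [OF analytic_imp_holomorphic]) (auto intro!: analytic_intros)
  define F where "F z = H z / (K (z - of_real y) * sinh (z + of_real y))" for z
  have nzK: "K (z - of_real y) \<noteq> 0" if "z \<in> S" for z
  proof
    assume K_0: "K (z - of_real y) = 0"
    then have "z - of_real y \<noteq> 0" using K0 by auto
    moreover have "sinh (z - of_real y) = 0" using K_0 K [of "z - of_real y"] by simp
    ultimately show False
      using that by (subst (asm) sinh_eq_0_in_strip) (auto simp: S_def)
  qed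
  have nzs: "sinh (z + of_real y) \<noteq> 0" if "z \<in> S" for z
    using that by (subst sinh_eq_0_in_strip) (auto simp: S_def complex_eq_iff)
  have "(\<lambda>z. sinh (z + of_real y)) holomorphic_on S"
    by (intro analytic_imp_holomorphic analytic_on_sinh analytic_on_add analytic_on_ident analytic_on_const)
  moreover have "(\<lambda>z. K (z - of_real y)) holomorphic_on S"
    by (rule holomorphic_on_compose_gen [OF _ holK, unfolded o_def]) (auto intro!: holomorphic_intros)
  ultimately have holF: "F holomorphic_on S"
    unfolding F_def [abs_def]
    by (intro holomorphic_intros) (auto simp: nzK nzs intro: holomorphic_on_subset [OF holH])
  have yS: "of_real y \<in> S" using y by (intro strip) auto
  have Fy: "F (of_real y) = 1 / of_real y"
    using y nzs [OF yS] by (simp add: F_def K0 H_def)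
  let ?a = "Complex 0 (- (pi / 2))" and ?b = "Complex R (pi / 2)"
  define G where "G z = F z / (z - of_real y)" for z
  show ?thesis
  proof
    have box: "of_real y \<in> box ?a ?b"
      using y pi_gt_zero by (auto simp: in_box_complex_iff)
    have "((\<lambda>z. F z / (z - of_real y)) has_contour_integral
        (2 * pi * \<i> * winding_number (rectpath ?a ?b) (of_real y) * F (of_real y))) (rectpath ?a ?b)"
    proof (rule Cauchy_integral_formula_convex_simple [OF S(2) holF])
      show "of_real y \<in> interior S" using yS S by (simp add: interior_open)
      have "path_image (rectpath ?a ?b) = cbox ?a ?b - box ?a ?b"
        using y by (intro path_image_rectpath_cbox_minus_box) auto
      moreover have "cbox ?a ?b \<subseteq> S"
      proof
        fix z assume "z \<in> cbox ?a ?b"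
        then have "Re z \<ge> 0" "\<bar>Im z\<bar> \<le> pi / 2" by (auto simp: in_cbox_complex_iff abs_le_iff)
        then show "z \<in> S" by (rule strip)
      qed
      ultimately show "path_image (rectpath ?a ?b) \<subseteq> S - {of_real y}"
        using box by blast
    qed simp_all
    then show "(G has_contour_integral 2 * pi * \<i> / y) (rectpath ?a ?b)"
      unfolding winding_number_rectpath [OF box] Fy G_def [abs_def, symmetric] by simp
    show "continuous_on ({z. Re z \<ge> 0 \<and> \<bar>Im z\<bar> \<le> pi / 2} - {of_real y}) G"
      unfolding G_def [abs_def]
    proof (rule continuous_on_divide [OF _ continuous_on_diff [OF continuous_on_id continuous_on_const]])
      show "continuous_on ({z. Re z \<ge> 0 \<and> \<bar>Im z\<bar> \<le> pi / 2} - {of_real y}) F"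
        by (rule continuous_on_subset [OF holomorphic_on_imp_continuous_on [OF holF]])
          (auto intro: strip)
    qed auto
    show "G z = strip_kernel y z" if "z \<noteq> 0" "z \<noteq> of_real y" for z
    proof -
      have "G z = H z / ((K (z - of_real y) * (z - of_real y)) * sinh (z + of_real y))"
        unfolding G_def F_def divide_divide_eq_left by (simp only: mult_ac)
      also have "\<dots> = H z / ((sinh z)\<^sup>2 - (sinh (of_real y))\<^sup>2)"
        by (simp only: K sinh_diff_times_sinh_add)
      also have "\<dots> = strip_kernel y z"
        using that(1) unfolding H_def strip_kernel_def sinh_of_real by simp
      finally show ?thesis .
    qed
  qed
qed

lemma sinh_Complex: "sinh (Complex s c) = Complex (sinh s * cos c) (cosh s * sin c)"
proof -
  have ii: "\<i> * (\<i> * of_real c) = - complex_of_real c"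
    by (simp add: complex_eq_iff)
  have "sinh (\<i> * of_real c) = \<i> * complex_of_real (sin c)"
    unfolding sinh_conv_sin ii sin_minus sin_of_real by simp
  moreover have "cosh (\<i> * of_real c) = complex_of_real (cos c)"
    unfolding cosh_conv_cos ii cos_minus cos_of_real by simp
  ultimately show ?thesis
    unfolding Complex_eq [of s c] sinh_add sinh_of_real cosh_of_real by (simp add: complex_eq_iff)
qed

lemma norm_sinh_Complex: "(norm (sinh (Complex s c)))\<^sup>2 = (sinh s)\<^sup>2 + (sin c)\<^sup>2"
proof -
  have "(norm (sinh (Complex s c)))\<^sup>2 = (sinh s)\<^sup>2 * (cos c)\<^sup>2 + (cosh s)\<^sup>2 * (sin c)\<^sup>2"
    by (simp add: sinh_Complex cmod_power2 power_mult_distrib)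
  also have "\<dots> = (sinh s)\<^sup>2 + (sin c)\<^sup>2"
    by (simp add: cosh_square_eq cos_squared_eq algebra_simps)
  finally show ?thesis .
qed

lemma double_Complex: "2 * Complex s t = Complex (2 * s) (2 * t)"
  by (simp add: complex_eq_iff)

text \<open>On \<open>Im z = \<plusminus> pi / 2\<close> the factor other than \<open>1 / z\<close> is real and equal on both edges, so the
  difference only sees the imaginary part of \<open>1 / z\<close>.\<close>
lemma strip_kernel_long_edges:
  "strip_kernel y (Complex s (- (pi / 2))) - strip_kernel y (Complex s (pi / 2)) =
     \<i> * of_real (long_edges y s)"
proof -
  have sh: "sinh (2 * Complex s (pi / 2)) = - of_real (sinh (2 * s))"
    "sinh (2 * Complex s (- (pi / 2))) = - of_real (sinh (2 * s))"
    "(sinh (Complex s (pi / 2)))\<^sup>2 = - of_real ((cosh s)\<^sup>2)"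
    "(sinh (Complex s (- (pi / 2))))\<^sup>2 = - of_real ((cosh s)\<^sup>2)"
    by (simp_all add: double_Complex sinh_Complex complex_eq_iff power2_eq_square)
  define D where "D = (cosh s)\<^sup>2 + (sinh y)\<^sup>2"
  have D: "D > 0" unfolding D_def by (intro add_pos_nonneg) auto
  define c where "c = pi / 2"
  have c: "c > 0" "s\<^sup>2 + c\<^sup>2 > 0" by (auto simp: c_def intro!: add_nonneg_pos)
  have nz: "Complex s c \<noteq> 0" "Complex s (- c) \<noteq> 0" using c by (auto simp: complex_eq_iff)
  have prod: "Complex s c * Complex s (- c) = of_real (s\<^sup>2 + c\<^sup>2)"
    by (simp add: complex_eq_iff power2_eq_square)
  have "strip_kernel y (Complex s (- c)) - strip_kernel y (Complex s c) =
      of_real (sinh (2 * s) / D) * (1 / Complex s (- c) - 1 / Complex s c)"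
  proof -
    have "- of_real ((cosh s)\<^sup>2) - of_real ((sinh y)\<^sup>2) = - (of_real D :: complex)"
      by (simp add: D_def)
    then have "strip_kernel y (Complex s t) = of_real (sinh (2 * s) / D) * (1 / Complex s t)"
      if "t = c \<or> t = - c" for t
      using that sh unfolding strip_kernel_def c_def [symmetric] by auto
    then show ?thesis by (simp add: right_diff_distrib)
  qed
  also have "1 / Complex s (- c) - 1 / Complex s c =
      (Complex s c - Complex s (- c)) / (Complex s c * Complex s (- c))"
    using nz by (simp add: field_simps)
  also have "\<dots> = \<i> * of_real (2 * c / (s\<^sup>2 + c\<^sup>2))"
    unfolding prod by (simp add: complex_eq_iff)
  finally show ?thesis
    by (simp add: c_def D_def long_edges_def)
qed

lemma strip_kernel_left_edge:
  "strip_kernel y (Complex 0 t) = - of_real (left_edge y t)"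
proof -
  define N where "N = (sin t)\<^sup>2 + (sinh y)\<^sup>2"
  have 1: "sinh (2 * Complex 0 t) = \<i> * of_real (sin (2 * t))"
    unfolding double_Complex sinh_Complex by (simp add: complex_eq_iff)
  have 2: "(sinh (Complex 0 t))\<^sup>2 - of_real ((sinh y)\<^sup>2) = - of_real N"
    by (simp add: N_def sinh_Complex complex_eq_iff power2_eq_square)
  have 3: "Complex 0 t = \<i> * of_real t" by (simp add: Complex_eq)
  have "strip_kernel y (Complex 0 t) =
      (\<i> * of_real (sin (2 * t))) / ((\<i> * of_real t) * - of_real N)"
    unfolding strip_kernel_def 1 2 by (simp only: 3)
  then show ?thesis by (simp add: left_edge_def N_def [symmetric])
qed

lemma norm_sinh_bounds:
  fixes z :: complex
  shows "sinh (Re z) \<le> norm (sinh z)" "norm (sinh z) \<le> cosh (Re z)"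
proof -
  have eq: "(norm (sinh z))\<^sup>2 = (sinh (Re z))\<^sup>2 + (sin (Im z))\<^sup>2"
    using norm_sinh_Complex [of "Re z" "Im z"] by simp
  show "sinh (Re z) \<le> norm (sinh z)"
    by (rule power2_le_imp_le [OF _ norm_ge_zero]) (simp add: eq)
  have "(sin (Im z))\<^sup>2 \<le> 1" by (simp add: abs_square_le_1)
  then have "(norm (sinh z))\<^sup>2 \<le> (cosh (Re z))\<^sup>2"
    by (simp add: eq cosh_square_eq)
  then show "norm (sinh z) \<le> cosh (Re z)"
    by (rule power2_le_imp_le) simp
qed

lemma norm_strip_kernel_right_edge:
  assumes "0 < y" "y < R"
  shows "norm (strip_kernel y (Complex R t)) \<le> cosh (2 * R) / (R * ((sinh R)\<^sup>2 - (sinh y)\<^sup>2))"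
proof -
  have gap: "(sinh R)\<^sup>2 - (sinh y)\<^sup>2 > 0"
    using assms by (simp add: power_strict_mono)
  have "R \<le> norm (Complex R t)" using abs_Re_le_cmod [of "Complex R t"] assms by simp
  moreover have "(sinh R)\<^sup>2 - (sinh y)\<^sup>2 \<le> norm ((sinh (Complex R t))\<^sup>2 - of_real ((sinh y)\<^sup>2))"
  proof -
    have "(sinh R)\<^sup>2 \<le> (norm (sinh (Complex R t)))\<^sup>2"
      using norm_sinh_bounds(1) [of "Complex R t"] assms by (intro power_mono) auto
    then show ?thesis
      using norm_triangle_ineq2 [of "(sinh (Complex R t))\<^sup>2" "of_real ((sinh y)\<^sup>2)"]
      by (simp add: norm_power)
  qed
  ultimately have "R * ((sinh R)\<^sup>2 - (sinh y)\<^sup>2) \<le>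
      norm (Complex R t * ((sinh (Complex R t))\<^sup>2 - of_real ((sinh y)\<^sup>2)))"
    unfolding norm_mult using gap assms by (intro mult_mono) auto
  moreover have "norm (sinh (2 * Complex R t)) \<le> cosh (2 * R)"
    using norm_sinh_bounds(2) [of "2 * Complex R t"] by simp
  moreover have "0 < R * ((sinh R)\<^sup>2 - (sinh y)\<^sup>2)" using gap assms by simp
  ultimately show ?thesis
    unfolding strip_kernel_def norm_divide by (intro frac_le) simp_all
qed

section \<open>The reciprocal of the inverse hyperbolic sine of the square root\<close>

lemma nn_integral_improper:
  fixes g :: "real \<Rightarrow> real"
  assumes [measurable]: "g \<in> borel_measurable borel" and nonneg: "\<And>u. g u \<ge> 0"
    and zero: "\<And>u. u < a \<Longrightarrow> g u = 0"
    and int: "\<And>n. n \<ge> N \<Longrightarrow> (g has_integral J n) {a..real n}"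
    and lim: "J \<longlonglongrightarrow> L"
  shows "(\<integral>\<^sup>+ u. ennreal (g u) \<partial>lborel) = ennreal L"
proof -
  define G where "G n u = ennreal (indicator {a..real n} u * g u)" for n u
  have G_meas: "G n \<in> borel_measurable borel" for n
    unfolding G_def [abs_def] by measurable
  have inc: "incseq G"
    using nonneg by (auto simp: incseq_def le_fun_def G_def indicator_def)
  have G: "(\<integral>\<^sup>+ u. G n u \<partial>lborel) = ennreal (J n)" if "n \<ge> N" for n
    unfolding G_def
  proof (rule nn_integral_has_integral_lborel)
    have "((\<lambda>u. if u \<in> {a..real n} then g u else 0) has_integral J n) UNIV"
      using int [OF that] by (simp only: has_integral_restrict_UNIV)
    also have "(\<lambda>u. if u \<in> {a..real n} then g u else 0) = (\<lambda>u. indicator {a..real n} u * g u)"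
      by (auto simp: fun_eq_iff)
    finally show "((\<lambda>u. indicator {a..real n} u * g u) has_integral J n) UNIV" .
  qed (auto simp: nonneg)
  have SUP: "(SUP n. G n u) = ennreal (g u)" for u
  proof (rule antisym)
    show "(SUP n. G n u) \<le> ennreal (g u)"
      using nonneg by (intro SUP_least) (auto simp: G_def indicator_def)
    obtain n where "u \<le> real n" using real_arch_simple by blast
    then have "ennreal (g u) = G n u"
      using zero [of u] by (cases "u < a") (auto simp: G_def)
    then show "ennreal (g u) \<le> (SUP n. G n u)" by (metis SUP_upper UNIV_I)
  qed
  have "(\<lambda>n. \<integral>\<^sup>+ u. G n u \<partial>lborel) \<longlonglongrightarrow> (SUP n. \<integral>\<^sup>+ u. G n u \<partial>lborel)"
    using inc by (intro LIMSEQ_SUP) (auto simp: incseq_def le_fun_def intro!: nn_integral_mono)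
  also have "(SUP n. \<integral>\<^sup>+ u. G n u \<partial>lborel) = (\<integral>\<^sup>+ u. ennreal (g u) \<partial>lborel)"
    using nn_integral_monotone_convergence_SUP [OF inc, of lborel] 
    by (simp add: SUP G_meas)
  finally have 1: "(\<lambda>n. \<integral>\<^sup>+ u. G n u \<partial>lborel) \<longlonglongrightarrow> (\<integral>\<^sup>+ u. ennreal (g u) \<partial>lborel)" .
  have "(\<lambda>n. ennreal (J n)) \<longlonglongrightarrow> ennreal L"
    by (rule tendsto_ennrealI [OF lim])
  then have 2: "(\<lambda>n. \<integral>\<^sup>+ u. G n u \<partial>lborel) \<longlonglongrightarrow> ennreal L"
    by (rule Lim_transform_eventually)
      (auto simp: G eventually_sequentially intro!: exI [of _ N])
  from LIMSEQ_unique [OF 1 2] show ?thesis .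
qed

text \<open>The imaginary part of the contour integral, split into edges: \<open>a\<close> comes from the left edge,
  \<open>b\<close> from the two long edges, and the bound is that for the right edge, of length \<open>pi\<close>.\<close>
lemma contour_estimate:
  assumes y: "0 < y" "y < R"
  obtains a b where "(left_edge y has_integral a) {- (pi / 2)..pi / 2}"
    and "(long_edges y has_integral b) {0..R}"
    and "\<bar>2 * pi / y - a - b\<bar> \<le> pi * (cosh (2 * R) / (R * ((sinh R)\<^sup>2 - (sinh y)\<^sup>2)))"
proof -
  define c where "c = pi / 2"
  have c: "c > 0" by (simp add: c_def)
  obtain G where int: "(G has_contour_integral 2 * pi * \<i> / y) (rectpath (Complex 0 (- c)) (Complex R c))"
    and cont: "continuous_on ({z. Re z \<ge> 0 \<and> \<bar>Im z\<bar> \<le> c} - {of_real y}) G"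
    and G: "\<And>z. z \<noteq> 0 \<Longrightarrow> z \<noteq> of_real y \<Longrightarrow> G z = strip_kernel y z"
    using contour_integral_strip_kernel [OF y] unfolding c_def by blast
  have integrable: "G contour_integrable_on (linepath u v)"
    if "u \<in> {z. Re z \<ge> 0 \<and> \<bar>Im z\<bar> \<le> c}" "v \<in> {z. Re z \<ge> 0 \<and> \<bar>Im z\<bar> \<le> c}"
      "of_real y \<notin> closed_segment u v" for u v
  proof -
    have "convex ({z. Re z \<ge> 0} \<inter> ({z. Im z \<le> c} \<inter> {z. Im z \<ge> - c}))"
      by (intro convex_Int convex_halfspace_Re_ge convex_halfspace_Im_le convex_halfspace_Im_ge)
    also have "{z. Re z \<ge> 0} \<inter> ({z. Im z \<le> c} \<inter> {z. Im z \<ge> - c}) = {z. Re z \<ge> 0 \<and> \<bar>Im z\<bar> \<le> c}"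
      by auto
    finally have "closed_segment u v \<subseteq> {z. Re z \<ge> 0 \<and> \<bar>Im z\<bar> \<le> c}"
      using that by (intro closed_segment_subset)
    with that show ?thesis
      by (intro contour_integrable_continuous_linepath continuous_on_subset [OF cont]) auto
  qed
  let ?ll = "Complex 0 (- c)" and ?lr = "Complex R (- c)"
    and ?ur = "Complex R c" and ?ul = "Complex 0 c"
  have bot: "G contour_integrable_on (linepath ?ll ?lr)"
    using y c by (intro integrable) (auto simp: closed_segment_same_Im)
  have right: "G contour_integrable_on (linepath ?lr ?ur)"
    using y c by (intro integrable) (auto simp: closed_segment_same_Re)
  have top: "G contour_integrable_on (linepath ?ul ?ur)"
    using y c by (intro integrable) (auto simp: closed_segment_same_Im)
  have left: "G contour_integrable_on (linepath ?ll ?ul)"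
    using y c by (intro integrable) (auto simp: closed_segment_same_Re)
  define B T L E where "B = contour_integral (linepath ?ll ?lr) G"
    and "T = contour_integral (linepath ?ul ?ur) G"
    and "L = contour_integral (linepath ?ll ?ul) G"
    and "E = contour_integral (linepath ?lr ?ur) G"
  note hB = has_contour_integral_integral [OF bot, folded B_def]
    and hT = has_contour_integral_integral [OF top, folded T_def]
    and hL = has_contour_integral_integral [OF left, folded L_def]
    and hE = has_contour_integral_integral [OF right, folded E_def]
  have "(G has_contour_integral B + (E + (- T + - L))) (rectpath ?ll ?ur)"
    unfolding rectpath_def Let_def complex.sel
    by (intro has_contour_integral_join hB hE has_contour_integral_reverse_linepath hT hL) auto
  from has_contour_integral_unique [OF int this]
  have total: "2 * pi * \<i> / y = B + (E + (- T + - L))" .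
  show thesis
  proof
    have "((\<lambda>t. G (Complex 0 t)) has_integral - \<i> * L) {- c..c}"
      using hL c has_contour_integral_linepath_same_Re_iff [of ?ll 0 ?ul "- c" c G L] by simp
    then have "((\<lambda>t. - complex_of_real (left_edge y t)) has_integral - \<i> * L) {- c..c}"
      \<comment> \<open>At the origin \<open>left_edge\<close> has the default value of a division by \<open>0\<close>.\<close>
    proof (rule has_integral_spike [OF negligible_sing [of 0], rotated])
      fix t assume "t \<in> {- c..c} - {0}"
      then have "Complex 0 t \<noteq> 0" "Complex 0 t \<noteq> of_real y"
        using y by (simp_all add: complex_eq_iff)
      from G [OF this] show "- complex_of_real (left_edge y t) = G (Complex 0 t)"
        unfolding strip_kernel_left_edge by (rule sym)
    qed
    from has_integral_neg [OF has_integral_linear [OF this bounded_linear_Re]]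
    have "((\<lambda>t. - (Re \<circ> (\<lambda>t. - complex_of_real (left_edge y t))) t) has_integral - Re (- \<i> * L))
        {- c..c}" .
    moreover have "(\<lambda>t. - (Re \<circ> (\<lambda>t. - complex_of_real (left_edge y t))) t) = left_edge y"
      by (simp add: fun_eq_iff)
    moreover have "- Re (- \<i> * L) = - Im L" by simp
    ultimately show "(left_edge y has_integral - Im L) {- (pi / 2)..pi / 2}"
      unfolding c_def by simp
    have "((\<lambda>s. G (Complex s (- c)) - G (Complex s c)) has_integral (B - T)) {0..R}"
      using has_integral_diff [of "\<lambda>s. G (Complex s (- c))" B "{0..R}" "\<lambda>s. G (Complex s c)" T]
        hB hT y by (simp add: has_contour_integral_linepath_same_Im_iff)
    also have "(\<lambda>s. G (Complex s (- c)) - G (Complex s c)) = (\<lambda>s. \<i> * of_real (long_edges y s))"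
    proof
      fix s
      have "G (Complex s (- c)) - G (Complex s c) =
          strip_kernel y (Complex s (- c)) - strip_kernel y (Complex s c)"
        using c G [of "Complex s (- c)"] G [of "Complex s c"] by (simp add: complex_eq_iff)
      then show "G (Complex s (- c)) - G (Complex s c) = \<i> * of_real (long_edges y s)"
        using strip_kernel_long_edges [of y s] by (simp add: c_def)
    qed
    finally show "(long_edges y has_integral Im (B - T)) {0..R}"
      by (auto dest: has_integral_linear [OF _ bounded_linear_Im] simp: o_def)
    define M where "M = cosh (2 * R) / (R * ((sinh R)\<^sup>2 - (sinh y)\<^sup>2))"
    have "norm E \<le> M * norm (?ur - ?lr)"
      unfolding E_def
    proof (rule contour_integral_bound_linepath [OF right])
      have "(sinh R)\<^sup>2 - (sinh y)\<^sup>2 > 0"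
        using y by (simp add: power_strict_mono)
      then show "0 \<le> M" using y by (simp add: M_def)
      fix z assume "z \<in> closed_segment ?lr ?ur"
      then have z: "z = Complex R (Im z)"
        by (simp add: closed_segment_same_Re complex_eq_iff)
      then have "Re z = R" by (metis complex.sel(1))
      then have "z \<noteq> 0" "z \<noteq> of_real y" using y by auto
      then have "G z = strip_kernel y (Complex R (Im z))" using G z by metis
      then show "norm (G z) \<le> M"
        using norm_strip_kernel_right_edge [OF y, of "Im z"] by (simp add: M_def)
    qed
    also have "norm (?ur - ?lr) = pi"
      by (simp add: c_def cmod_def)
    finally have "\<bar>Im E\<bar> \<le> pi * M"
      using abs_Im_le_cmod [of E] by (simp add: mult.commute)
    moreover have "2 * pi / y = Im (2 * pi * \<i> / y)"
      by (simp add: Im_divide_of_real)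
    then have "2 * pi / y - (- Im L) - Im (B - T) = Im E"
      unfolding total by simp
    ultimately show "\<bar>2 * pi / y - (- Im L) - Im (B - T)\<bar> \<le>
        pi * (cosh (2 * R) / (R * ((sinh R)\<^sup>2 - (sinh y)\<^sup>2)))"
      by (simp only: M_def)
  qed
qed

text \<open>Both pieces of the measure are parametrised on one line: the left edge, which is symmetric, by
  \<open>u\<close> in \<open>(- pi / 2, 0)\<close>, and the long edges by \<open>u \<ge> 0\<close>. In terms of \<open>t = p u\<close> the densities are
  \<open>1 / (pi arcsin (sqrt t))\<close> on \<open>(0, 1)\<close> and
  \<open>1 / (2 ((arcosh (sqrt t))\<^sup>2 + pi\<^sup>2 / 4))\<close> on \<open>[1, \<infinity>)\<close>.\<close>
lemma stieltjes_inverse_a_fun: "stieltjes_function (\<lambda>x. 1 / a_fun x)"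
proof (rule stieltjes_functionI)
  define w p :: "real \<Rightarrow> real" where
    "w u = (if u \<ge> 0 then sinh (2 * u) / (2 * (u\<^sup>2 + (pi / 2)\<^sup>2))
        else if u > - (pi / 2) then sin (2 * u) / (pi * u) else 0)" and
    "p u = (if u \<ge> 0 then (cosh u)\<^sup>2 else if u > - (pi / 2) then (sin u)\<^sup>2 else 1)" for u
  have sin2: "sin (2 * u) < 0" if "u < 0" "u > - (pi / 2)" for u :: real
    using sin_gt_zero [of "- 2 * u"] that by simp
  show w: "w u \<ge> 0" for u
    using sin2 [of u] by (auto simp: w_def intro!: divide_nonpos_nonpos mult_nonneg_nonpos)
  show p: "p u > 0" for u
    using sin2 [of u] by (auto simp: p_def sin_double)
  show w_meas: "w \<in> borel_measurable borel"
    unfolding w_def [abs_def] sinh_field_def by measurable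
  show p_meas: "p \<in> borel_measurable borel"
    unfolding p_def [abs_def] cosh_field_def by measurable
  show "1 / a_fun x \<ge> 0" if "x > 0" for x
    using a_fun_pos [OF that] by simp
  show "(\<integral>\<^sup>+ u. ennreal (w u / (x + p u)) \<partial>lborel) = ennreal (1 / a_fun x)" if "x > 0" for x
  proof -
    define y where "y = a_fun x"
    have y: "y > 0" "x = (sinh y)\<^sup>2" using that by (simp_all add: y_def a_fun_def)
    define g where "g u = w u / (x + p u)" for u
    define err where "err R = cosh (2 * R) / (R * ((sinh R)\<^sup>2 - (sinh y)\<^sup>2)) / 2" for R
    define N where "N = nat \<lceil>y\<rceil> + 1"
    have N: "real n > y" if "n \<ge> N" for n using that unfolding N_def by linarith
    have "\<exists>j. (g has_integral j) {- (pi / 2)..real n} \<and> \<bar>1 / y - j\<bar> \<le> err (real n)"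
      if n: "n \<ge> N" for n
    proof -
      obtain a b where a: "(left_edge y has_integral a) {- (pi / 2)..pi / 2}"
        and b: "(long_edges y has_integral b) {0..real n}"
        and est: "\<bar>2 * pi / y - a - b\<bar> \<le>
            pi * (cosh (2 * real n) / (real n * ((sinh (real n))\<^sup>2 - (sinh y)\<^sup>2)))"
        by (rule contour_estimate [OF y(1) N [OF n]])
      have "left_edge y integrable_on {- (pi / 2)..0}"
        by (rule integrable_subinterval_real [OF has_integral_integrable [OF a]]) auto
      then obtain d where d: "(left_edge y has_integral d) {- (pi / 2)..0}"
        by (auto simp: integrable_on_def)
      have even: "left_edge y (- t) = left_edge y t" for t
        by (simp add: left_edge_def)
      have "((\<lambda>t. left_edge y (- t)) has_integral d) {- (pi / 2)..- 0}"
        unfolding even using d by simp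
      then have "(left_edge y has_integral d) {0..pi / 2}"
        by (rule has_integral_reflect_real [THEN iffD1])
      with d have "(left_edge y has_integral d + d) {- (pi / 2)..pi / 2}"
        by (intro has_integral_combine [of "- (pi / 2)" 0]) auto
      from has_integral_unique [OF a this] have ad: "a = 2 * d" by simp
      have 1: "(g has_integral d / pi) {- (pi / 2)..0}"
      proof (rule has_integral_spike [of "{- (pi / 2), 0}"])
        show "((\<lambda>t. left_edge y t / pi) has_integral d / pi) {- (pi / 2)..0}"
          by (rule has_integral_divide [OF d])
        show "g t = left_edge y t / pi" if "t \<in> {- (pi / 2)..0} - {- (pi / 2), 0}" for t
          using that by (auto simp: g_def w_def p_def left_edge_def y(2) add.commute mult_ac)
      qed auto
      have 2: "(g has_integral b / (2 * pi)) {0..real n}"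
      proof (rule has_integral_eq)
        show "((\<lambda>s. long_edges y s / (2 * pi)) has_integral b / (2 * pi)) {0..real n}"
          by (rule has_integral_divide [OF b])
        show "long_edges y s / (2 * pi) = g s" if "s \<in> {0..real n}" for s
          using that by (simp add: g_def w_def p_def long_edges_def y(2) add.commute mult_ac)
      qed
      have g: "(g has_integral d / pi + b / (2 * pi)) {- (pi / 2)..real n}"
        by (rule has_integral_combine [OF _ _ 1 2]) auto
      have "1 / y - (d / pi + b / (2 * pi)) = (2 * pi / y - a - b) / (2 * pi)"
        by (simp add: ad diff_divide_distrib)
      then have "\<bar>1 / y - (d / pi + b / (2 * pi))\<bar> = \<bar>2 * pi / y - a - b\<bar> / (2 * pi)"
        by (simp add: abs_divide)
      also have "\<dots> \<le> (pi * (2 * err (real n))) / (2 * pi)"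
        using est by (intro divide_right_mono) (simp_all add: err_def)
      finally have "\<bar>1 / y - (d / pi + b / (2 * pi))\<bar> \<le> err (real n)"
        by simp
      with g show ?thesis by blast
    qed
    then obtain J where J: "\<And>n. n \<ge> N \<Longrightarrow> (g has_integral J n) {- (pi / 2)..real n}"
      "\<And>n. n \<ge> N \<Longrightarrow> \<bar>1 / y - J n\<bar> \<le> err (real n)" by metis
    have "(\<lambda>n. err (real n)) \<longlonglongrightarrow> 0"
      unfolding err_def sinh_field_def cosh_field_def by real_asymp
    then have "(\<lambda>n. 1 / y - J n) \<longlonglongrightarrow> 0"
      by (rule Lim_null_comparison [rotated])
        (use J(2) in \<open>auto simp: eventually_sequentially\<close>)
    then have lim: "J \<longlonglongrightarrow> 1 / y"
      using tendsto_diff [OF tendsto_const [of "1 / y"]] by fastforce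
    have "(\<integral>\<^sup>+ u. ennreal (g u) \<partial>lborel) = ennreal (1 / y)"
    proof (rule nn_integral_improper [OF _ _ _ J(1) lim])
      show "g \<in> borel_measurable borel"
        unfolding g_def [abs_def] using w_meas p_meas by measurable
      show "g u \<ge> 0" for u using w [of u] p [of u] that by (simp add: g_def)
      show "g u = 0" if "u < - (pi / 2)" for u
      proof -
        have "u < 0" using that pi_gt_zero by linarith
        with that show ?thesis by (simp add: g_def w_def)
      qed
    qed
    then show ?thesis by (simp add: g_def y_def)
  qed
qed

section \<open>The two Stieltjes factors and their product\<close>

theorem mainTheorem12:
  shows "(\<forall>x>0. a_fun differentiable (at x) \<and> phi_fun differentiable (at x)) \<and>
    (\<forall>x>0. h_fun x = 2 * deriv a_fun x * (1 / a_fun x)) \<and>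
    (\<forall>x>0. h_fun x = 1 / (sqrt x * sqrt (1 + x) * arsinh (sqrt x))) \<and>
    stieltjes_function (deriv a_fun) \<and>
    stieltjes_function (\<lambda>x. 1 / a_fun x) \<and>
    completely_monotone h_fun \<and>
    \<not> stieltjes_function h_fun"
proof (intro conjI allI impI)
  fix x :: real assume x: "x > 0"
  show "a_fun differentiable (at x)"
    using a_fun_has_deriv [OF x] by (auto simp: real_differentiable_def)
  show "phi_fun differentiable (at x)"
    using phi_fun_has_deriv [OF x] by (auto simp: real_differentiable_def)
qed (rule h_fun_eq h_fun_explicit stieltjes_deriv_a_fun stieltjes_inverse_a_fun
    completely_monotone_h_fun not_stieltjes_h_fun; assumption?)+

end
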